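(* Let $M$ be a monomial ideal of $S$. Then the Taylor resolution $\mathbb{T}_M$ of $S/M$ is minimal if and only if $M$ is dominant.
   Context: $S$ is a polynomial ring in finitely many variables over an arbitrary field. For a monomial ideal $M$ of $S$ with minimal (monomial) generating set $G=\{l_1,\dots,l_q\}$, the Taylor resolution $\mathbb{T}_M$ is the multigraded free resolution of $S/M$ whose free module in homological degree $j$ has basis the symbols $[l_{r_1},\dots,l_{r_j}]$ with $r_1<\dots<r_j$ (one for each $j$-element subset of $G$), where $\operatorname{mdeg}[l_{r_1},\dots,l_{r_j}]=\operatorname{lcm}(l_{r_1},\dots,l_{r_j})$ (multidegrees are written as monomials, and $\operatorname{mdeg}[\varnothing]=1$), and whose differential is $$f_j([l_{r_1},\dots,l_{r_j}])=\sum_{i=1}^j(-1)^{i+1}\frac{\operatorname{mdeg}[l_{r_1},\dots,l_{r_j}]}{\operatorname{mdeg}[l_{r_1},\dots,\widehat{l_{r_i}},\dots,l_{r_j}]}[l_{r_1},\dots,\widehat{l_{r_i}},\dots,l_{r_j}].$$ It is minimal if no differential matrix contains an invertible entry. Given a set $G$ of monomials, $m\in G$ is a dominant monomial (with respect to $G$) if there are a variable $x$ and a positive integer $k$ such that $x^k\mid m$ and $x^k\nmid m'$ for all $m'\in G\setminus\{m\}$. The set $G$ is dominant if every $m\in G$ is dominant with respect to $G$. A monomial ideal is dominant if its minimal generating set is dominant. *)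

theory Defs
  imports Complex_Main "HOL-Library.Poly_Mapping" "HOL-Library.Sublist"
begin

section \<open>Monomials and polynomials\<close>

text \<open>
  A monomial in the variables \<^typ>\<open>'v\<close> is its exponent vector, so the product of monomials is
  addition of exponents and the monomial 1 is the exponent vector 0.
\<close>

type_synonym 'v monom = "'v \<Rightarrow>\<^sub>0 nat"

type_synonym ('v, 'k) polyn = "'v monom \<Rightarrow>\<^sub>0 'k"

definition mon :: "'v monom \<Rightarrow> ('v, 'k::field) polyn" where
  "mon t = Poly_Mapping.single t 1"

definition mdvd :: "'v monom \<Rightarrow> 'v monom \<Rightarrow> bool" where
  "mdvd s t \<longleftrightarrow> (\<exists>u. t = s + u)"

lift_definition mlcm :: "'v monom \<Rightarrow> 'v monom \<Rightarrow> 'v monom" is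
  "\<lambda>s t x. max (s x) (t x)"
proof -
  fix s t :: "'v \<Rightarrow> nat"
  assume "finite {x. s x \<noteq> 0}" "finite {x. t x \<noteq> 0}"
  then have "finite ({x. s x \<noteq> 0} \<union> {x. t x \<noteq> 0})" by simp
  then show "finite {x. max (s x) (t x) \<noteq> 0}"
    by (rule rev_finite_subset) auto
qed

lemma mdvd_iff: "mdvd s t \<longleftrightarrow> (\<forall>x. Poly_Mapping.lookup s x \<le> Poly_Mapping.lookup t x)"
proof
  assume "\<forall>x. Poly_Mapping.lookup s x \<le> Poly_Mapping.lookup t x"
  then have "t = s + (t - s)"
    by (intro poly_mapping_eqI) (simp add: lookup_add lookup_minus)
  then show "mdvd s t" unfolding mdvd_def by blast
qed (auto simp: mdvd_def lookup_add)

lemma mlcm_is_least_common_multiple: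
  "mdvd (mlcm s t) u \<longleftrightarrow> mdvd s u \<and> mdvd t u"
  by (auto simp: mdvd_iff mlcm.rep_eq)


section \<open>Monomial ideals and their minimal generating sets\<close>

lemma module_ring: "module ((*) :: 'a::comm_ring_1 \<Rightarrow> 'a \<Rightarrow> 'a)"
  by unfold_locales (auto simp: algebra_simps)

definition ideal_of :: "'v monom set \<Rightarrow> ('v, 'k::field) polyn set" where
  "ideal_of L = module.span (*) (mon ` L)"

definition monomial_ideal :: "('v, 'k::field) polyn set \<Rightarrow> bool" where
  "monomial_ideal M \<longleftrightarrow> (\<exists>L. M = ideal_of L)"

definition minimal_generating_set :: "'v monom set \<Rightarrow> ('v, 'k::field) polyn set \<Rightarrow> bool" where
  "minimal_generating_set G M \<longleftrightarrow> ideal_of G = M \<and> (\<forall>H. H \<subset> G \<longrightarrow> ideal_of H \<noteq> M)"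


section \<open>Dominance\<close>

text \<open>The monomial \<open>x\<^sup>k\<close> is \<^term>\<open>Poly_Mapping.single x k\<close>.\<close>

definition dominant_monomial :: "'v monom \<Rightarrow> 'v monom set \<Rightarrow> bool" where
  "dominant_monomial m G \<longleftrightarrow>
     (\<exists>x k. k > 0 \<and> mdvd (Poly_Mapping.single x k) m \<and>
        (\<forall>m'\<in>G - {m}. \<not> mdvd (Poly_Mapping.single x k) m'))"

definition dominant_set :: "'v monom set \<Rightarrow> bool" where
  "dominant_set G \<longleftrightarrow> (\<forall>m\<in>G. dominant_monomial m G)"

text \<open>
  In finitely many variables a monomial ideal has exactly one minimal monomial generating set, so
  the quantifier below only names it.
\<close>

definition dominant_ideal :: "('v, 'k::field) polyn set \<Rightarrow> bool" where
  "dominant_ideal M \<longleftrightarrow> (\<exists>G. minimal_generating_set G M \<and> dominant_set G)"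


section \<open>Based complexes of free modules\<close>

text \<open>
  A complex of free modules with chosen bases; \<open>diff C j b\<close> is the image of the basis element
  \<open>b\<close> of homological degree \<open>j\<close>, written as a finitely supported combination of the basis
  elements of degree \<open>j - 1\<close>.
\<close>

record (overloaded) ('b, 'r) based_complex =
  basis :: "nat \<Rightarrow> 'b set"
  diff :: "nat \<Rightarrow> 'b \<Rightarrow> ('b \<Rightarrow>\<^sub>0 'r)"

definition diff_matrix :: "('b, 'r::comm_ring_1) based_complex \<Rightarrow> nat \<Rightarrow> 'b \<Rightarrow> 'b \<Rightarrow> 'r" where
  "diff_matrix C j b' b = Poly_Mapping.lookup (diff C j b) b'"

definition minimal_complex :: "('b, 'r::comm_ring_1) based_complex \<Rightarrow> bool" where
  "minimal_complex C \<longleftrightarrow>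
     (\<forall>j\<ge>1. \<forall>b\<in>basis C j. \<forall>b'\<in>basis C (j - 1). \<not> diff_matrix C j b' b dvd 1)"


section \<open>The Taylor resolution\<close>

definition mdeg :: "'v monom list \<Rightarrow> 'v monom" where
  "mdeg ts = foldr mlcm ts 0"

definition omit :: "nat \<Rightarrow> 'a list \<Rightarrow> 'a list" where
  "omit i ts = take i ts @ drop (Suc i) ts"

text \<open>
  \<open>ls = [l\<^sub>1, \<dots>, l\<^sub>q]\<close> lists the minimal generators without repetition. The symbol
  \<open>[l\<^sub>r\<^sub>1, \<dots>, l\<^sub>r\<^sub>j]\<close> with \<open>r\<^sub>1 < \<dots> < r\<^sub>j\<close> is the corresponding subsequence of \<open>ls\<close>.
  Positions are counted from 0, hence the sign \<open>(-1)\<^sup>i\<close>; the subtraction of exponent vectors is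
  the quotient of monomials, the subtrahend always dividing.
\<close>

definition taylor_diff :: "'v monom list \<Rightarrow> ('v monom list \<Rightarrow>\<^sub>0 ('v, 'k::field) polyn)" where
  "taylor_diff ts =
     (\<Sum>i<length ts. Poly_Mapping.single (omit i ts) ((- 1) ^ i * mon (mdeg ts - mdeg (omit i ts))))"

definition taylor_resolution ::
    "'v monom list \<Rightarrow> ('v monom list, ('v, 'k::field) polyn) based_complex" where
  "taylor_resolution ls =
     \<lparr> basis = (\<lambda>j. {ts. subseq ts ls \<and> length ts = j}),
       diff = (\<lambda>j. taylor_diff) \<rparr>"

end

theory Submission
  imports Defs
begin

text \<open>
  The entry of the Taylor differential between \<open>ts\<close> and \<open>omit i ts\<close> is, up to sign, the monomial
  \<open>mdeg ts / mdeg (omit i ts)\<close>, and all other entries vanish. A monomial is invertible only if it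
  is 1, so the resolution fails to be minimal exactly when, for some symbol \<open>ts\<close>, deleting one
  generator leaves the least common multiple unchanged (\<open>taylor_entries_nonunit_iff\<close>).

  Comparing exponents variable by variable, the least common multiple drops on deletion of \<open>m\<close> iff
  some variable occurs in \<open>m\<close> with an exponent strictly larger than in every other listed
  generator; this is dominance of \<open>m\<close> among the listed generators
  (\<open>mdeg_omit_neq_iff_dominant\<close>). Dominance passes to smaller sets, so it suffices to look at
  the symbol that contains every generator.

  The remaining point is that dominance of an ideal speaks of some minimal generating set, while
  the resolution is built from a given one. The two agree because minimal monomial generating sets
  are unique (\<open>minimal_generating_set_unique\<close>), which in turn rests on the fact that a monomial
  lies in a monomial ideal only if one of the generators divides it.
\<close>

section \<open>Uniqueness of minimal monomial generating sets\<close>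

lemma mdvd_trans: "mdvd s t \<Longrightarrow> mdvd t u \<Longrightarrow> mdvd s u"
  unfolding mdvd_iff by (meson order_trans)

lemma mdvd_antisym: "mdvd s t \<Longrightarrow> mdvd t s \<Longrightarrow> s = t"
  by (intro poly_mapping_eqI antisym) (auto simp: mdvd_iff)

text \<open>
  The polynomials all of whose monomials are multiples of generators form an ideal that contains
  the generators, hence contain everything they generate.
\<close>

lemma keys_in_ideal_of:
  fixes p :: "('v, 'k::field) polyn"
  assumes "p \<in> ideal_of G" "t \<in> Poly_Mapping.keys p"
  shows "\<exists>g\<in>G. mdvd g t"
proof -
  interpret module "(*) :: ('v, 'k) polyn \<Rightarrow> ('v, 'k) polyn \<Rightarrow> ('v, 'k) polyn"
    by (rule module_ring)
  let ?I = "{p :: ('v, 'k) polyn. \<forall>t\<in>Poly_Mapping.keys p. \<exists>g\<in>G. mdvd g t}"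
  have "subspace ?I"
  proof (rule subspaceI)
    fix p q :: "('v, 'k) polyn" assume "p \<in> ?I" "q \<in> ?I"
    then show "p + q \<in> ?I" using Poly_Mapping.keys_add[of p q] by blast
  next
    fix c p :: "('v, 'k) polyn" assume p: "p \<in> ?I"
    show "c * p \<in> ?I"
    proof (intro CollectI ballI)
      fix t assume "t \<in> Poly_Mapping.keys (c * p)"
      then obtain a b where "t = a + b" and b: "b \<in> Poly_Mapping.keys p"
        using keys_mult[of c p] by blast
      then have "mdvd b t" by (auto simp: mdvd_iff lookup_add)
      with p b show "\<exists>g\<in>G. mdvd g t" using mdvd_trans by blast
    qed
  qed simp
  moreover have "mon ` G \<subseteq> ?I"
    by (auto simp: mon_def mdvd_iff)
  ultimately have "ideal_of G \<subseteq> ?I"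
    unfolding ideal_of_def by (intro span_minimal)
  with assms show ?thesis by blast
qed

lemma mon_in_ideal_of_iff:
  "(mon t :: ('v, 'k::field) polyn) \<in> ideal_of G \<longleftrightarrow> (\<exists>g\<in>G. mdvd g t)"
proof
  assume "(mon t :: ('v, 'k) polyn) \<in> ideal_of G"
  then show "\<exists>g\<in>G. mdvd g t"
    by (rule keys_in_ideal_of) (simp add: mon_def)
next
  interpret module "(*) :: ('v, 'k) polyn \<Rightarrow> ('v, 'k) polyn \<Rightarrow> ('v, 'k) polyn"
    by (rule module_ring)
  assume "\<exists>g\<in>G. mdvd g t"
  then obtain g u where g: "g \<in> G" and "t = u + g"
    by (auto simp: mdvd_def add.commute)
  then have "(mon t :: ('v, 'k) polyn) = mon u * mon g"
    by (simp add: mon_def mult_single)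
  moreover have "(mon u * mon g :: ('v, 'k) polyn) \<in> ideal_of G"
    unfolding ideal_of_def using g by (intro span_scale span_base) simp
  ultimately show "(mon t :: ('v, 'k) polyn) \<in> ideal_of G" by simp
qed

text \<open>
  A generator with a proper divisor among the other generators could be discarded.
\<close>

lemma minimal_generating_set_antichain:
  fixes M :: "('v, 'k::field) polyn set"
  assumes min: "minimal_generating_set G M" and "g \<in> G" "h \<in> G" "mdvd h g"
  shows "h = g"
proof (rule ccontr)
  interpret module "(*) :: ('v, 'k) polyn \<Rightarrow> ('v, 'k) polyn \<Rightarrow> ('v, 'k) polyn"
    by (rule module_ring)
  let ?I = "ideal_of (G - {g}) :: ('v, 'k) polyn set"
  assume "h \<noteq> g"
  have "mon s \<in> ?I" if "s \<in> G" for s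
  proof (cases "s = g")
    case True
    with assms \<open>h \<noteq> g\<close> show ?thesis
      by (auto simp: mon_in_ideal_of_iff intro!: bexI[of _ h])
  next
    case False
    with that show ?thesis
      by (auto simp: mon_in_ideal_of_iff mdvd_iff intro!: bexI[of _ s])
  qed
  then have "ideal_of G \<subseteq> ?I"
    unfolding ideal_of_def by (intro span_minimal subspace_span) auto
  moreover have "?I \<subseteq> ideal_of G"
    unfolding ideal_of_def by (intro span_mono) auto
  ultimately have "?I = M"
    using min by (auto simp: minimal_generating_set_def)
  moreover have "G - {g} \<subset> G" using \<open>g \<in> G\<close> by blast
  ultimately show False
    using min by (auto simp: minimal_generating_set_def)
qed

text \<open>
  A minimal generator \<open>g\<close> of one set is divisible by some \<open>h\<close> of the other, which is divisible
  by some \<open>g'\<close> of the first; the first set being an antichain, all three coincide.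
\<close>

lemma minimal_generating_set_subset:
  fixes M :: "('v, 'k::field) polyn set"
  assumes G: "minimal_generating_set G M" and H: "minimal_generating_set H M"
  shows "G \<subseteq> H"
proof
  fix g assume g: "g \<in> G"
  have eq: "(ideal_of G :: ('v, 'k) polyn set) = ideal_of H"
    using G H by (simp add: minimal_generating_set_def)
  have "(mon g :: ('v, 'k) polyn) \<in> ideal_of G"
    using g by (auto simp: mon_in_ideal_of_iff mdvd_iff)
  then obtain h where h: "h \<in> H" "mdvd h g"
    unfolding eq mon_in_ideal_of_iff by blast
  have "(mon h :: ('v, 'k) polyn) \<in> ideal_of H"
    using h by (auto simp: mon_in_ideal_of_iff mdvd_iff)
  then obtain g' where g': "g' \<in> G" "mdvd g' h"
    unfolding eq[symmetric] mon_in_ideal_of_iff by blast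
  have "g' = g"
    using minimal_generating_set_antichain[OF G g g'(1)] g' h mdvd_trans by blast
  with g' h have "h = g" using mdvd_antisym by blast
  with h show "g \<in> H" by simp
qed

lemma minimal_generating_set_unique:
  "minimal_generating_set G M \<Longrightarrow> minimal_generating_set H M \<Longrightarrow> G = H"
  by (intro equalityI minimal_generating_set_subset)


section \<open>Dominance and least common multiples\<close>

text \<open>
  The best choice of \<open>k\<close> is the full exponent of \<open>x\<close> in \<open>m\<close>. The condition \<open>k > 0\<close> survives as
  positivity of that exponent; it matters when \<open>m\<close> is the only generator, for then it
  excludes \<open>m = 1\<close>.
\<close>

lemma dominant_monomial_iff:
  "dominant_monomial m G \<longleftrightarrow>
     (\<exists>x. Poly_Mapping.lookup m x > 0 \<and>
        (\<forall>m'\<in>G - {m}. Poly_Mapping.lookup m' x < Poly_Mapping.lookup m x))"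
proof -
  have *: "mdvd (Poly_Mapping.single x k) t \<longleftrightarrow> k \<le> Poly_Mapping.lookup t x"
    for x k and t :: "'a monom"
    by (auto simp: mdvd_iff lookup_single when_def)
  show ?thesis
    unfolding dominant_monomial_def * not_le
    by (meson less_le_trans order_refl)
qed

lemma dominant_monomial_mono:
  "dominant_monomial m G \<Longrightarrow> H \<subseteq> G \<Longrightarrow> dominant_monomial m H"
  unfolding dominant_monomial_def by blast

lemma mdeg_mdvd_iff: "mdvd (mdeg ts) u \<longleftrightarrow> (\<forall>t\<in>set ts. mdvd t u)"
  proof (induction ts)
  case Nil
  show ?case by (simp add: mdeg_def mdvd_iff)
qed (simp add: mdeg_def mlcm_is_least_common_multiple)

lemma lookup_mdeg_less_iff:
  "Poly_Mapping.lookup (mdeg ts) x < n \<longleftrightarrow>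
     0 < n \<and> (\<forall>t\<in>set ts. Poly_Mapping.lookup t x < n)"
  by (induction ts) (auto simp: mdeg_def mlcm.rep_eq)

lemma set_omit:
  assumes "distinct ts" "i < length ts"
  shows "set (omit i ts) = set ts - {ts ! i}"
proof -
  have ts: "ts = take i ts @ ts ! i # drop (Suc i) ts"
    using assms by (simp add: id_take_nth_drop)
  then have "distinct (take i ts @ ts ! i # drop (Suc i) ts)"
    using assms by simp
  moreover have "set ts = insert (ts ! i) (set (take i ts) \<union> set (drop (Suc i) ts))"
    by (subst ts) auto
  ultimately show ?thesis by (auto simp: omit_def)
qed

lemma length_omit: "i < length ts \<Longrightarrow> length (omit i ts) = length ts - 1"
  by (auto simp: omit_def)

lemma subseq_omit:
  assumes "i < length ts"
  shows "subseq (omit i ts) ts"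
proof -
  have "subseq (take i ts @ drop (Suc i) ts) (take i ts @ ts ! i # drop (Suc i) ts)"
    by (intro list_emb_append_mono) auto
  then show ?thesis using assms by (simp add: omit_def flip: id_take_nth_drop)
qed

lemma set_subseq: "subseq xs ys \<Longrightarrow> set xs \<subseteq> set ys"
  by (auto elim: list_emb_set)

lemma distinct_subseq: "subseq xs ys \<Longrightarrow> distinct ys \<Longrightarrow> distinct xs"
  by (induction rule: list_emb.induct) (auto dest: set_subseq)

lemma mdeg_omit_mdvd:
  assumes "distinct ts" "i < length ts"
  shows "mdvd (mdeg (omit i ts)) (mdeg ts)"
proof -
  have "\<forall>t\<in>set ts. mdvd t (mdeg ts)"
    using mdeg_mdvd_iff[of ts "mdeg ts"] by (simp add: mdvd_iff)
  then show ?thesis using assms by (simp add: mdeg_mdvd_iff set_omit)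
qed

text \<open>
  Deleting a generator changes the least common multiple iff the generator does not divide the
  least common multiple of the others, that is, iff it exceeds that in some exponent.
\<close>

lemma mdeg_omit_neq_iff_dominant:
  assumes "distinct ts" "i < length ts"
  shows "mdeg (omit i ts) \<noteq> mdeg ts \<longleftrightarrow> dominant_monomial (ts ! i) (set ts)"
proof -
  have "mdeg (omit i ts) = mdeg ts \<longleftrightarrow> mdvd (mdeg ts) (mdeg (omit i ts))"
    using mdeg_omit_mdvd[OF assms] mdvd_antisym by (auto simp: mdvd_iff)
  also have "\<dots> \<longleftrightarrow> mdvd (ts ! i) (mdeg (omit i ts))"
  proof -
    have "\<forall>t\<in>set ts - {ts ! i}. mdvd t (mdeg (omit i ts))"
      using mdeg_mdvd_iff[of "omit i ts" "mdeg (omit i ts)"] assms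
      by (simp add: mdvd_iff set_omit)
    then show ?thesis
      using assms nth_mem by (fastforce simp: mdeg_mdvd_iff)
  qed
  finally show ?thesis
    using assms by (simp add: mdvd_iff not_le lookup_mdeg_less_iff dominant_monomial_iff set_omit)
qed


section \<open>Entries of the Taylor differential\<close>

lemma mon_dvd_one_iff: "(mon t :: ('v, 'k::field) polyn) dvd 1 \<longleftrightarrow> t = 0"
proof
  assume "(mon t :: ('v, 'k) polyn) dvd 1"
  then obtain p :: "('v, 'k) polyn" where "1 = mon t * p" by (elim dvdE)
  \<comment> \<open>The monomial 1 occurs in the product, and all monomials of the product are multiples of
    \<open>t\<close>.\<close>
  then have "0 \<in> Poly_Mapping.keys (mon t * p)"
    by (metis keys_one singletonI)
  then obtain u where "t + u = 0"
    using keys_mult[of "mon t" p] by (auto simp: mon_def)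
  then have "mdvd t 0" by (metis mdvd_def)
  then show "t = 0" by (intro mdvd_antisym) (simp_all add: mdvd_iff)
qed (simp add: mon_def)

lemma lookup_taylor_diff:
  "Poly_Mapping.lookup (taylor_diff ts :: 'v monom list \<Rightarrow>\<^sub>0 ('v, 'k::field) polyn) b =
     (\<Sum>i<length ts. (- 1) ^ i * mon (mdeg ts - mdeg (omit i ts)) when omit i ts = b)"
  by (simp add: taylor_diff_def lookup_sum lookup_single)

text \<open>
  The generators being distinct, different deletions give different symbols, so no two terms of
  the differential fall into the same entry and nothing cancels.
\<close>

lemma lookup_taylor_diff_omit:
  assumes "distinct ts" "i < length ts"
  shows "Poly_Mapping.lookup (taylor_diff ts) (omit i ts) =
           ((- 1) ^ i * mon (mdeg ts - mdeg (omit i ts)) :: ('v, 'k::field) polyn)"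
proof -
  have "omit j ts = omit i ts \<longleftrightarrow> j = i" if "j < length ts" for j
  proof
    assume "omit j ts = omit i ts"
    then have "set ts - {ts ! j} = set ts - {ts ! i}"
      using assms that set_omit by metis
    then have "ts ! j = ts ! i" using assms nth_mem that by blast
    then show "j = i" using assms that nth_eq_iff_index_eq by blast
  qed simp
  then have "Poly_Mapping.lookup (taylor_diff ts) (omit i ts) =
      (\<Sum>j<length ts. if j = i
         then (- 1) ^ j * mon (mdeg ts - mdeg (omit j ts)) else (0 :: ('v, 'k) polyn))"
    unfolding lookup_taylor_diff by (intro sum.cong) (auto simp: when_def)
  then show ?thesis using assms by simp
qed

lemma taylor_entry_omit_dvd_one_iff:
  assumes "distinct ts" "i < length ts"
  shows "(Poly_Mapping.lookup (taylor_diff ts) (omit i ts) :: ('v, 'k::field) polyn) dvd 1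
           \<longleftrightarrow> mdeg (omit i ts) = mdeg ts"
proof -
  have "((- 1) ^ i * p) dvd 1 \<longleftrightarrow> p dvd 1" for p :: "('v, 'k) polyn"
    by (cases "even i") auto
  then have "(Poly_Mapping.lookup (taylor_diff ts) (omit i ts) :: ('v, 'k) polyn) dvd 1
      \<longleftrightarrow> mdeg ts - mdeg (omit i ts) = 0"
    using assms by (simp add: lookup_taylor_diff_omit mon_dvd_one_iff)
  \<comment> \<open>Subtraction of exponents truncates, but the subtrahend divides, so a zero difference means
    equality.\<close>
  moreover obtain u where "mdeg ts = mdeg (omit i ts) + u"
    using mdeg_omit_mdvd[OF assms] by (auto simp: mdvd_def)
  ultimately show ?thesis by auto
qed

lemma taylor_entries_nonunit_iff:
  assumes "distinct ts"
  shows "(\<forall>b. \<not> (Poly_Mapping.lookup (taylor_diff ts) b :: ('v, 'k::field) polyn) dvd 1)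
           \<longleftrightarrow> (\<forall>i<length ts. mdeg (omit i ts) \<noteq> mdeg ts)"
proof
  assume R: "\<forall>i<length ts. mdeg (omit i ts) \<noteq> mdeg ts"
  show "\<forall>b. \<not> (Poly_Mapping.lookup (taylor_diff ts) b :: ('v, 'k) polyn) dvd 1"
  proof
    fix b
    show "\<not> (Poly_Mapping.lookup (taylor_diff ts) b :: ('v, 'k) polyn) dvd 1"
    proof (cases "\<exists>i<length ts. b = omit i ts")
      case True
      with R assms show ?thesis using taylor_entry_omit_dvd_one_iff by blast
    next
      case False
      then have "(Poly_Mapping.lookup (taylor_diff ts) b :: ('v, 'k) polyn) = 0"
        unfolding lookup_taylor_diff by (intro sum.neutral) (auto simp: when_def)
      then show ?thesis by simp
    qed
  qed
qed (use assms taylor_entry_omit_dvd_one_iff in blast)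

text \<open>
  Minimality quantifies over the basis of the complex only. A deletion from a subsequence of \<open>ls\<close>
  is a subsequence one shorter, so every possibly invertible entry is among those quantified over.
\<close>

lemma minimal_taylor_resolution_iff:
  assumes "distinct ls"
  shows "minimal_complex (taylor_resolution ls :: ('v monom list, ('v, 'k::field) polyn) based_complex)
           \<longleftrightarrow> (\<forall>ts. subseq ts ls \<longrightarrow> (\<forall>i<length ts. mdeg (omit i ts) \<noteq> mdeg ts))"
    (is "?L \<longleftrightarrow> ?R")
proof
  assume L: ?L
  show ?R
  proof (intro allI impI)
    fix ts i assume ts: "subseq ts ls" and i: "i < length ts"
    have "distinct ts" using ts assms distinct_subseq by blast
    moreover have "subseq (omit i ts) ls"
      using subseq_omit[OF i] ts subseq_order.order_trans by blast
    moreover have "length ts \<ge> 1" using i by linarith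
    ultimately have "\<not> (Poly_Mapping.lookup (taylor_diff ts) (omit i ts) :: ('v, 'k) polyn) dvd 1"
      using L ts length_omit[OF i]
      unfolding minimal_complex_def taylor_resolution_def diff_matrix_def by simp
    then show "mdeg (omit i ts) \<noteq> mdeg ts"
      using taylor_entry_omit_dvd_one_iff \<open>distinct ts\<close> i by blast
  qed
next
  assume R: ?R
  have "\<not> (Poly_Mapping.lookup (taylor_diff ts) b :: ('v, 'k) polyn) dvd 1"
    if "subseq ts ls" for ts b
    using R that assms distinct_subseq taylor_entries_nonunit_iff[where 'k = 'k, of ts] by blast
  then show ?L
    by (auto simp: minimal_complex_def taylor_resolution_def diff_matrix_def)
qed


section \<open>Minimality of the Taylor resolution\<close>

theorem theorem4p4:
  fixes M :: "('v::finite, 'k::field) polyn set"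
    and ls :: "'v monom list"
  assumes "monomial_ideal M"
    and "distinct ls"
    and "minimal_generating_set (set ls) M"
  shows "minimal_complex (taylor_resolution ls :: ('v monom list, ('v, 'k) polyn) based_complex)
         \<longleftrightarrow> dominant_ideal M"
proof -
  have "dominant_ideal M \<longleftrightarrow> dominant_set (set ls)"
    unfolding dominant_ideal_def using assms minimal_generating_set_unique by blast
  also have "\<dots> \<longleftrightarrow>
      (\<forall>ts. subseq ts ls \<longrightarrow> (\<forall>i<length ts. dominant_monomial (ts ! i) (set ts)))"
  proof
    assume D: "dominant_set (set ls)"
    show "\<forall>ts. subseq ts ls \<longrightarrow> (\<forall>i<length ts. dominant_monomial (ts ! i) (set ts))"
    proof (intro allI impI)
      fix ts i assume "subseq ts ls" "i < length ts"
      moreover from this have "set ts \<subseteq> set ls"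
        using set_subseq by blast
      ultimately show "dominant_monomial (ts ! i) (set ts)"
        using D dominant_monomial_mono nth_mem unfolding dominant_set_def by blast
    qed
  next
    assume "\<forall>ts. subseq ts ls \<longrightarrow> (\<forall>i<length ts. dominant_monomial (ts ! i) (set ts))"
    then show "dominant_set (set ls)"
      unfolding dominant_set_def by (metis in_set_conv_nth subseq_order.order_refl)
  qed
  also have "\<dots> \<longleftrightarrow> (\<forall>ts. subseq ts ls \<longrightarrow> (\<forall>i<length ts. mdeg (omit i ts) \<noteq> mdeg ts))"
    using mdeg_omit_neq_iff_dominant distinct_subseq \<open>distinct ls\<close> by blast
  also have "\<dots> \<longleftrightarrow>
      minimal_complex (taylor_resolution ls :: ('v monom list, ('v, 'k) polyn) based_complex)"
    by (rule minimal_taylor_resolution_iff[OF \<open>distinct ls\<close>, symmetric])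
  finally show ?thesis by (rule sym)
qed

end
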